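(* Let $\mathbb{X}$ be a linearly ordered radicable idempotent semifield, let $n\ge 1$, let $A,C\in\mathbb{X}^{n\times n}$ and $g\in\mathbb{X}^{n}$. Assume that the spectral radius $\lambda$ of $A$ satisfies $\lambda>\mathbb{0}$ and that $\operatorname{Tr}(C)\le\mathbb{1}$. Consider the problem of minimising $x^{-}Ax$ over all regular vectors $x\in\mathbb{X}_{+}^{n}$ subject to $Cx\le x$ and $g\le x$. Put $$\theta=\lambda\oplus\bigoplus_{k=1}^{n-1}\ \bigoplus_{1\le i_{1}+\cdots+i_{k}\le n-k}\operatorname{tr}^{1/k}(AC^{i_{1}}AC^{i_{2}}\cdots AC^{i_{k}}),$$ where the inner sum is over all tuples of non-negative integers $(i_{1},\ldots,i_{k})$ satisfying the indicated inequalities. Then the minimum in the problem exists and equals $\theta$, and a regular vector $x\in\mathbb{X}_{+}^{n}$ is a solution of the problem (that is, it is feasible and attains the minimum) if and only if $$x=(\theta^{-1}A\oplus C)^{\ast}u$$ for some regular vector $u\in\mathbb{X}_{+}^{n}$ with $u\ge g$.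
   Context: A linearly ordered radicable idempotent semifield is a set $\mathbb{X}$ with two associative, commutative operations $\oplus$ (addition, neutral element $\mathbb{0}$) and $\otimes$ (multiplication, neutral element $\mathbb{1}$, sign omitted), with multiplication distributive over addition, $\mathbb{0}$ absorbing for multiplication, $\mathbb{0}\ne\mathbb{1}$, such that: $x\oplus x=x$ for all $x$; every $x\in\mathbb{X}_{+}=\mathbb{X}\setminus\{\mathbb{0}\}$ has a multiplicative inverse $x^{-1}$; the order defined by $x\le y\iff x\oplus y=y$ is total; and for every $x\in\mathbb{X}$ and integer $p\ge1$ there is a (then unique) $x^{1/p}$ with $(x^{1/p})^{p}=x$ (so rational powers are defined, $\mathbb{0}^{1/p}=\mathbb{0}$). Example: $(\mathbb{R}\cup\{-\infty\},\max,+)$ with $\mathbb{0}=-\infty$, $\mathbb{1}=0$. Vectors and matrices over $\mathbb{X}$ are added, multiplied, and scaled by the usual formulas with $\oplus,\otimes$ in place of $+,\times$; inequalities between vectors are component-wise. $I$ is the identity matrix ($\mathbb{1}$ on the diagonal, $\mathbb{0}$ elsewhere), $A^{0}=I$, $A^{p}=A^{p-1}A$. A vector is regular if all its components are different from $\mathbb{0}$; $\mathbb{X}_{+}^{n}$ is the set of regular vectors. For a regular column vector $x=(x_{i})$, $x^{-}$ is the row vector $(x_{i}^{-1})$. For $A\in\mathbb{X}^{n\times n}$: $\operatorname{tr}A=a_{11}\oplus\cdots\oplus a_{nn}$; $\operatorname{tr}^{1/k}(A)=(\operatorname{tr}A)^{1/k}$; $\operatorname{Tr}(A)=\operatorname{tr}A\oplus\operatorname{tr}A^{2}\oplus\cdots\oplus\operatorname{tr}A^{n}$;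 $A^{\ast}=I\oplus A\oplus\cdots\oplus A^{n-1}$. The spectral radius of $A$ is its maximal eigenvalue, given by $\lambda=\bigoplus_{m=1}^{n}\operatorname{tr}^{1/m}(A^{m})$. An empty sum equals $\mathbb{0}$. *)

theory Defs
  imports "HOL-Analysis.Analysis"
begin

text \<open>
  The idempotent operations are written with the ordinary ring symbols: the symbols
  \<open>+\<close>, \<open>*\<close>, \<open>0\<close>, \<open>1\<close> of the class stand for
  \<open>\<oplus>\<close>, \<open>\<otimes>\<close>, \<open>\<zero>\<close>, \<open>\<one>\<close>, so that the library's
  \<open>**\<close>, \<open>*v\<close>, \<open>v*\<close>, \<open>*s\<close>, \<open>mat 1\<close>, \<open>trace\<close> and big
  sums are the idempotent ones. The value of \<open>inverse 0\<close> is left unspecified.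
\<close>

class radicable_idempotent_semifield = comm_semiring_1 + inverse + linorder +
  assumes add_idem: "x + x = x"
    and right_inverse_nonzero: "x \<noteq> 0 \<Longrightarrow> x * inverse x = 1"
    and divide_eq_mult_inverse: "x / y = x * inverse y"
    and le_iff_add_eq: "x \<le> y \<longleftrightarrow> x + y = y"
    and radicable: "p \<ge> 1 \<Longrightarrow> \<exists>y. y ^ p = x"

definition nth_root :: "nat \<Rightarrow> 'a::radicable_idempotent_semifield \<Rightarrow> 'a" where
  "nth_root p x = (THE y. y ^ p = x)"

lemma zero_le: "(0::'a::radicable_idempotent_semifield) \<le> x"
  by (simp add: le_iff_add_eq)

lemma mult_mono_left: "(x::'a::radicable_idempotent_semifield) \<le> y \<Longrightarrow> z * x \<le> z * y"
  by (metis le_iff_add_eq distrib_left)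

lemma nonzero_mult_cancel:
  fixes x y z :: "'a::radicable_idempotent_semifield"
  assumes "z \<noteq> 0" and "z * x = z * y"
  shows "x = y"
proof -
  have "inverse z * z = 1"
    using right_inverse_nonzero[OF assms(1)] by (simp add: mult.commute)
  then show ?thesis
    using assms(2) by (metis mult.assoc mult_1)
qed

lemma power_nonzero:
  fixes x :: "'a::radicable_idempotent_semifield"
  shows "x \<noteq> 0 \<Longrightarrow> x ^ p \<noteq> 0"
proof (induction p)
  case (Suc p)
  then show ?case
    using nonzero_mult_cancel[of x "x ^ p" 0] by auto
qed simp

lemma power_le_mono: "(x::'a::radicable_idempotent_semifield) \<le> y \<Longrightarrow> x ^ p \<le> y ^ p"
proof (induction p)
  case (Suc p)
  have "x * x ^ p \<le> x * y ^ p"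
    using Suc by (simp add: mult_mono_left)
  also have "\<dots> \<le> y * y ^ p"
    using mult_mono_left[OF Suc.prems, of "y ^ p"] by (simp add: mult.commute)
  finally show ?case by simp
qed simp

lemma power_inj_le:
  fixes x y :: "'a::radicable_idempotent_semifield"
  assumes "p \<ge> 1" and eq: "x ^ p = y ^ p" and le: "x \<le> y"
  shows "x = y"
proof (cases "y = 0")
  case True
  then show ?thesis using le zero_le[of x] by simp
next
  case False
  obtain q where p: "p = Suc q" using assms(1) by (cases p) auto
  have "y ^ q * y = x ^ q * x" using eq p by (simp add: mult.commute)
  also have "\<dots> \<le> y ^ q * x"
    using mult_mono_left[OF power_le_mono[OF le, of q], of x] by (simp add: mult.commute)
  finally have "y ^ q * y = y ^ q * x"
    using mult_mono_left[OF le, of "y ^ q"] by simp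
  then show ?thesis
    using nonzero_mult_cancel[OF power_nonzero[OF False]] by metis
qed

lemma nth_root_ex1:
  fixes x :: "'a::radicable_idempotent_semifield"
  assumes "p \<ge> 1"
  shows "\<exists>!y. y ^ p = x"
proof -
  have "y = z" if "y ^ p = z ^ p" for y z :: 'a
    using power_inj_le[OF assms, of y z] power_inj_le[OF assms, of z y] that
    by (metis linear)
  then show ?thesis using radicable[OF assms, of x] by metis
qed

lemma nth_root_power:
  "p \<ge> 1 \<Longrightarrow> nth_root p (x::'a::radicable_idempotent_semifield) ^ p = x"
  unfolding nth_root_def by (rule theI'[OF nth_root_ex1])

primrec matpow :: "'a::semiring_1 ^ 'n ^ 'n \<Rightarrow> nat \<Rightarrow> 'a ^ 'n ^ 'n" where
  "matpow A 0 = mat 1"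
| "matpow A (Suc p) = matpow A p ** A"

definition matscale :: "'a::times \<Rightarrow> 'a ^ 'n ^ 'm \<Rightarrow> 'a ^ 'n ^ 'm" where
  "matscale c A = (\<chi> i. c *s (A $ i))"

definition regular :: "'a::zero ^ 'n \<Rightarrow> bool" where
  "regular x \<longleftrightarrow> (\<forall>i. x $ i \<noteq> 0)"

definition conj_vec :: "'a::inverse ^ 'n \<Rightarrow> 'a ^ 'n" where
  "conj_vec x = (\<chi> i. inverse (x $ i))"

definition Tr :: "'a::semiring_1 ^ 'n ^ 'n \<Rightarrow> 'a" where
  "Tr A = (\<Sum>m=1..CARD('n). trace (matpow A m))"

definition kstar :: "'a::semiring_1 ^ 'n ^ 'n \<Rightarrow> 'a ^ 'n ^ 'n" where
  "kstar A = (\<Sum>m<CARD('n). matpow A m)"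

definition eigenvalue :: "'a::semiring_1 ^ 'n ^ 'n \<Rightarrow> 'a \<Rightarrow> bool" where
  "eigenvalue A c \<longleftrightarrow> (\<exists>x. x \<noteq> 0 \<and> A *v x = c *s x)"

text \<open>
  Every square matrix has a largest eigenvalue, namely
  \<open>\<Sum>m=1..n. nth_root m (trace (matpow A m))\<close>, so \<open>GREATEST\<close> is well defined here.
\<close>

definition spectral_radius :: "'a::radicable_idempotent_semifield ^ 'n ^ 'n \<Rightarrow> 'a" where
  "spectral_radius A = (GREATEST c. eigenvalue A c)"

text \<open>\<open>alt_prod A C [i\<^sub>1, \<dots>, i\<^sub>k]\<close> is the product
  \<open>A C\<^sup>i\<^sup>1 A C\<^sup>i\<^sup>2 \<dots> A C\<^sup>i\<^sup>k\<close>.\<close>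

primrec alt_prod ::
  "'a::semiring_1 ^ 'n ^ 'n \<Rightarrow> 'a ^ 'n ^ 'n \<Rightarrow> nat list \<Rightarrow> 'a ^ 'n ^ 'n" where
  "alt_prod A C [] = mat 1"
| "alt_prod A C (i # is) = A ** matpow C i ** alt_prod A C is"

definition exponent_tuples :: "nat \<Rightarrow> nat \<Rightarrow> nat list set" where
  "exponent_tuples n k = {is. length is = k \<and> 1 \<le> sum_list is \<and> sum_list is \<le> n - k}"

lemma finite_exponent_tuples: "finite (exponent_tuples n k)"
proof (rule finite_subset)
  show "exponent_tuples n k \<subseteq> {is. set is \<subseteq> {..n} \<and> length is = k}"
    unfolding exponent_tuples_def
    using member_le_sum_list by fastforce
qed (simp add: finite_lists_length_eq)

definition theta ::
  "'a::radicable_idempotent_semifield ^ 'n ^ 'n \<Rightarrow> 'a ^ 'n ^ 'n \<Rightarrow> 'a" where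
  "theta A C = spectral_radius A +
     (\<Sum>k=1..<CARD('n). \<Sum>is\<in>exponent_tuples CARD('n) k.
        nth_root k (trace (alt_prod A C is)))"

definition objective ::
  "'a::radicable_idempotent_semifield ^ 'n ^ 'n \<Rightarrow> 'a ^ 'n \<Rightarrow> 'a" where
  "objective A x = (\<Sum>i\<in>UNIV. (conj_vec x v* A) $ i * x $ i)"

definition feasible ::
  "'a::radicable_idempotent_semifield ^ 'n ^ 'n \<Rightarrow> 'a ^ 'n \<Rightarrow> 'a ^ 'n \<Rightarrow> bool" where
  "feasible C g x \<longleftrightarrow> regular x \<and> C *v x \<le> x \<and> g \<le> x"

end

theory Submission
  imports Defs
begin

text \<open>
  For regular \<open>x\<close>, the bound \<open>x\<^sup>- A x \<le> t\<close> says \<open>A x \<le> t x\<close>. Applying this and \<open>C x \<le> x\<close>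
  along \<open>A C\<^sup>i\<^sup>1 \<dots> A C\<^sup>i\<^sup>k\<close> bounds the trace of that product
  by \<open>t\<^sup>k\<close>, so \<open>\<theta> \<le> t\<close>. Conversely, let \<open>M = \<theta>\<^sup>-\<^sup>1 A \<oplus> C\<close>. Expanding \<open>M\<^sup>m\<close> and rotating each
  term under the trace gives exactly the products that occur in \<open>\<theta>\<close> and \<open>Tr C\<close>, so
  \<open>Tr M \<le> 1\<close>. Hence all cycles of \<open>M\<close> have weight at most \<open>1\<close>, cycles can be cut out of
  walks, and the solutions of \<open>M x \<le> x\<close> are the vectors \<open>M\<^sup>* u\<close>.
\<close>

\<comment> \<open>Order, inverses and roots in the semifield\<close>
\<comment> \<open>By idempotence, b = a + c gives a + b = b; conversely c = b is a witness. With
  \<open>dioid\<close> below, the monotonicity rules for sums and products become available.\<close>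
subclass (in radicable_idempotent_semifield) canonically_ordered_monoid_add
proof
  fix a b :: 'a
  show "a \<le> b \<longleftrightarrow> (\<exists>c. b = a + c)"
    by (metis le_iff_add_eq add_idem add.assoc)
qed

subclass (in radicable_idempotent_semifield) dioid ..

instance radicable_idempotent_semifield \<subseteq> semiring_1_no_zero_divisors
proof
  fix a b :: 'a
  assume "a \<noteq> 0" "b \<noteq> 0"
  then show "a * b \<noteq> 0"
    using nonzero_mult_cancel[of a b 0] by auto
qed

lemma mult_le_mult_iff:
  fixes x y z :: "'a::radicable_idempotent_semifield"
  assumes "z \<noteq> 0"
  shows "z * x \<le> z * y \<longleftrightarrow> x \<le> y"
  using nonzero_mult_cancel[OF assms] by (auto simp: le_iff_add_eq simp flip: distrib_left)

lemma inverse_mult_le_iff: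
  fixes x y z :: "'a::radicable_idempotent_semifield"
  assumes "z \<noteq> 0"
  shows "inverse z * x \<le> y \<longleftrightarrow> x \<le> z * y"
proof -
  have "z * (inverse z * x) = x"
    using right_inverse_nonzero[OF assms] by (metis mult.assoc mult_1)
  then show ?thesis
    using mult_le_mult_iff[OF assms, of "inverse z * x" y] by simp
qed

text \<open>Normalises bounds by powers to bounds by 1, for the later scaling of A by the inverse of
  its spectral radius or of \<open>theta\<close>.\<close>

lemma inverse_power_mult_le_one_iff:
  fixes x z :: "'a::radicable_idempotent_semifield"
  assumes "z \<noteq> 0"
  shows "inverse z ^ k * x \<le> 1 \<longleftrightarrow> x \<le> z ^ k"
proof -
  have "z ^ k * inverse z ^ k = 1"
    using right_inverse_nonzero[OF assms] by (simp flip: power_mult_distrib)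
  then have "z ^ k * (inverse z ^ k * x) = x"
    by (metis mult.assoc mult_1)
  then show ?thesis
    using mult_le_mult_iff[OF power_nonzero[OF assms], of k "inverse z ^ k * x" 1] by simp
qed

text \<open>The k-th power is monotone and, for k >= 1, injective on comparable elements, so
  totality of the order makes it reflect the order as well.\<close>

lemma nth_root_le_iff:
  fixes x t :: "'a::radicable_idempotent_semifield"
  assumes "k \<ge> 1"
  shows "nth_root k x \<le> t \<longleftrightarrow> x \<le> t ^ k"
proof
  assume "nth_root k x \<le> t"
  then show "x \<le> t ^ k"
    using power_le_mono[of "nth_root k x" t k] nth_root_power[OF assms] by metis
next
  assume *: "x \<le> t ^ k"
  show "nth_root k x \<le> t"
  proof (rule ccontr)
    assume "\<not> nth_root k x \<le> t"
    then have le: "t \<le> nth_root k x" and "t \<noteq> nth_root k x" by auto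
    have "t ^ k \<le> x"
      using power_le_mono[OF le, of k] nth_root_power[OF assms, of x] by simp
    then have "t ^ k = nth_root k x ^ k"
      using * nth_root_power[OF assms, of x] by simp
    then show False
      using power_inj_le[OF assms _ le] \<open>t \<noteq> nth_root k x\<close> by simp
  qed
qed

lemma le_nth_root_iff:
  fixes x t :: "'a::radicable_idempotent_semifield"
  assumes "k \<ge> 1"
  shows "t \<le> nth_root k x \<longleftrightarrow> t ^ k \<le> x"
proof
  assume "t \<le> nth_root k x"
  then show "t ^ k \<le> x"
    using power_le_mono[of t "nth_root k x" k] nth_root_power[OF assms, of x] by simp
next
  assume *: "t ^ k \<le> x"
  show "t \<le> nth_root k x"
  proof (cases "nth_root k x \<le> t")
    case True
    then have "x \<le> t ^ k" by (simp add: nth_root_le_iff[OF assms])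
    then have "nth_root k x ^ k = t ^ k"
      using * nth_root_power[OF assms, of x] by simp
    then show ?thesis using power_inj_le[OF assms _ True] by simp
  qed simp
qed

section \<open>Sums as maxima\<close>

lemma add_le_iff:
  fixes x y c :: "'a::radicable_idempotent_semifield"
  shows "x + y \<le> c \<longleftrightarrow> x \<le> c \<and> y \<le> c"
proof
  assume "x + y \<le> c"
  moreover have "x \<le> x + y" "y \<le> x + y"
    by (simp_all add: le_iff_add_eq add_idem add.left_commute flip: add.assoc)
  ultimately show "x \<le> c \<and> y \<le> c" by auto
next
  assume "x \<le> c \<and> y \<le> c"
  then show "x + y \<le> c" using add_mono[of x c y c] by (simp add: add_idem)
qed

lemma add_cases:
  fixes x y :: "'a::radicable_idempotent_semifield"
  shows "x + y = x \<or> x + y = y"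
  using le_iff_add_eq[of x y] le_iff_add_eq[of y x] linear[of x y] by (auto simp: add.commute)

lemma sum_le_iff:
  fixes f :: "'b \<Rightarrow> 'a::radicable_idempotent_semifield"
  assumes "finite S"
  shows "sum f S \<le> c \<longleftrightarrow> (\<forall>i\<in>S. f i \<le> c)"
  using assms by induction (auto simp: add_le_iff)

lemma le_sum:
  fixes f :: "'b \<Rightarrow> 'a::radicable_idempotent_semifield"
  assumes "finite S" "i \<in> S"
  shows "f i \<le> sum f S"
  using sum_le_iff[OF assms(1), of f "sum f S"] assms(2) by simp

text \<open>A nonempty sum is a maximum in a total order, so it equals one of its terms. This lets
  an entry of a matrix product be replaced by a single product of entries.\<close>

lemma sum_attained:
  fixes f :: "'b \<Rightarrow> 'a::radicable_idempotent_semifield"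
  assumes "finite S" "S \<noteq> {}"
  shows "\<exists>i\<in>S. sum f S = f i"
  using assms
proof (induction rule: finite_ne_induct)
  case (insert x F)
  then show ?case using add_cases[of "f x" "sum f F"] by auto
qed simp

section \<open>Matrix entries, powers and scaling\<close>

lemma matrix_mult_entry_attained:
  fixes A B :: "'a::radicable_idempotent_semifield ^ 'n ^ 'n"
  shows "\<exists>k. (A ** B) $ i $ j = A $ i $ k * B $ k $ j"
  using sum_attained[of UNIV "\<lambda>k. A $ i $ k * B $ k $ j"]
  by (auto simp: matrix_matrix_mult_def)

lemma matrix_mult_entry_ge:
  fixes A B :: "'a::radicable_idempotent_semifield ^ 'n ^ 'n"
  shows "A $ i $ k * B $ k $ j \<le> (A ** B) $ i $ j"
  using le_sum[of UNIV k "\<lambda>k. A $ i $ k * B $ k $ j"]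
  by (auto simp: matrix_matrix_mult_def)

lemma matrix_vector_mult_attained:
  fixes A :: "'a::radicable_idempotent_semifield ^ 'n ^ 'n"
  shows "\<exists>k. (A *v x) $ i = A $ i $ k * x $ k"
  using sum_attained[of UNIV "\<lambda>k. A $ i $ k * x $ k"]
  by (auto simp: matrix_vector_mult_def)

lemma matrix_vector_mult_ge:
  fixes A :: "'a::radicable_idempotent_semifield ^ 'n ^ 'n"
  shows "A $ i $ k * x $ k \<le> (A *v x) $ i"
  using le_sum[of UNIV k "\<lambda>k. A $ i $ k * x $ k"]
  by (auto simp: matrix_vector_mult_def)

lemma matrix_vector_mult_mono:
  fixes A :: "'a::radicable_idempotent_semifield ^ 'n ^ 'n"
  shows "x \<le> y \<Longrightarrow> A *v x \<le> A *v y"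
  by (auto simp: less_eq_vec_def matrix_vector_mult_def intro!: sum_mono mult_mono_left)

lemma matrix_vector_mult_scale:
  fixes A :: "'a::comm_semiring_1 ^ 'n ^ 'm"
  shows "A *v (c *s x) = c *s (A *v x)"
  by (simp add: vec_eq_iff matrix_vector_mult_def sum_distrib_left mult.left_commute)

lemma trace_le_iff:
  fixes A :: "'a::radicable_idempotent_semifield ^ 'n ^ 'n"
  shows "trace A \<le> c \<longleftrightarrow> (\<forall>i. A $ i $ i \<le> c)"
  by (simp add: trace_def sum_le_iff)

lemma Tr_le_iff:
  fixes A :: "'a::radicable_idempotent_semifield ^ 'n ^ 'n"
  shows "Tr A \<le> c \<longleftrightarrow> (\<forall>m\<in>{1..CARD('n)}. trace (matpow A m) \<le> c)"
  by (simp add: Tr_def sum_le_iff)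

lemma matpow_Suc_left: "matpow A (Suc p) = A ** matpow A p"
  by (induction p) (simp, metis matpow.simps(2) matrix_mul_assoc)

lemma matpow_add: "matpow A (p + q) = matpow A p ** matpow A q"
  by (induction q) (simp_all add: matrix_mul_assoc)

lemma matscale_entry: "matscale c A $ i $ j = c * A $ i $ j"
  by (simp add: matscale_def)

lemma matscale_mult:
  fixes A B :: "'a::comm_semiring_1 ^ 'n ^ 'n"
  shows "matscale c A ** B = matscale c (A ** B)"
    and "A ** matscale c B = matscale c (A ** B)"
  by (simp_all add: vec_eq_iff matscale_entry matrix_matrix_mult_def sum_distrib_left
      mult.assoc mult.left_commute)

lemma matscale_matscale:
  fixes A :: "'a::comm_semiring_1 ^ 'n ^ 'n"
  shows "matscale c (matscale d A) = matscale (c * d) A"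
  by (simp add: vec_eq_iff matscale_entry mult.assoc)

lemma matscale_one: "matscale 1 (A :: 'a::comm_semiring_1 ^ 'n ^ 'n) = A"
  by (simp add: vec_eq_iff matscale_entry)

lemma matscale_matrix_vector_mult:
  fixes A :: "'a::comm_semiring_1 ^ 'n ^ 'n"
  shows "matscale c A *v x = c *s (A *v x)"
  by (simp add: vec_eq_iff matscale_entry matrix_vector_mult_def sum_distrib_left mult.assoc)

lemma trace_matscale:
  fixes A :: "'a::comm_semiring_1 ^ 'n ^ 'n"
  shows "trace (matscale c A) = c * trace A"
  by (simp add: trace_def matscale_entry sum_distrib_left)

lemma matpow_matscale:
  fixes A :: "'a::comm_semiring_1 ^ 'n ^ 'n"
  shows "matpow (matscale c A) m = matscale (c ^ m) (matpow A m)"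
  by (induction m) (simp_all add: matscale_one matscale_mult matscale_matscale mult.commute)

lemma alt_prod_matscale:
  fixes A C :: "'a::comm_semiring_1 ^ 'n ^ 'n"
  shows "alt_prod (matscale c A) C is = matscale (c ^ length is) (alt_prod A C is)"
  by (induction "is") (simp_all add: matscale_one matscale_mult matscale_matscale mult.commute)

lemma alt_prod_append:
  "alt_prod A C (is @ [i]) = alt_prod A C is ** A ** matpow C i"
  by (induction "is") (simp_all add: matrix_mul_assoc)

text \<open>The all-zero lists, left out of \<open>exponent_tuples\<close>, recover the plain powers
  of A, through which the spectral radius enters \<open>theta\<close>.\<close>

lemma alt_prod_replicate_zero: "alt_prod A C (replicate k 0) = matpow A k"
proof (induction k)
  case (Suc k)
  then show ?case using matpow_Suc_left[of A k] by simp
qed simp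

section \<open>Walks and cycles\<close>

text \<open>An entry of a power is the maximal weight of a walk between its two indices, so any one
  walk bounds it from below. The interval from a to b allows segments of a longer walk.\<close>

lemma prod_walk_le_matpow:
  fixes A :: "'a::radicable_idempotent_semifield ^ 'n ^ 'n"
  assumes "a \<le> b"
  shows "(\<Prod>k=a..<b. A $ f k $ f (Suc k)) \<le> matpow A (b - a) $ f a $ f b"
  using assms
proof (induction b rule: dec_induct)
  case base
  then show ?case by (simp add: mat_def)
next
  case (step b)
  have "(\<Prod>k=a..<Suc b. A $ f k $ f (Suc k))
      = (\<Prod>k=a..<b. A $ f k $ f (Suc k)) * A $ f b $ f (Suc b)"
    using step by simp
  also have "\<dots> \<le> matpow A (b - a) $ f a $ f b * A $ f b $ f (Suc b)"
    using step by (intro mult_right_mono) auto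
  also have "\<dots> \<le> matpow A (Suc b - a) $ f a $ f (Suc b)"
    using matrix_mult_entry_ge[of "matpow A (b - a)"] step by (simp add: Suc_diff_le)
  finally show ?case .
qed

text \<open>Following the index that attains each product yields an optimal walk. For m = 0 the
  empty product is 1, which agrees with \<open>mat 1\<close> only on the diagonal.\<close>

lemma matpow_entry_walk:
  fixes A :: "'a::radicable_idempotent_semifield ^ 'n ^ 'n"
  assumes "m \<ge> 1 \<or> i = j"
  shows "\<exists>f. f 0 = i \<and> f m = j \<and> matpow A m $ i $ j = (\<Prod>k<m. A $ f k $ f (Suc k))"
  using assms
proof (induction m arbitrary: j)
  case 0
  then show ?case by (intro exI[of _ "\<lambda>_. i"]) (simp add: mat_def)
next
  case (Suc m)
  show ?case
  proof (cases "m = 0")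
    case True
    then show ?thesis by (intro exI[of _ "\<lambda>k. if k = 0 then i else j"]) simp
  next
    case False
    obtain l where l: "matpow A (Suc m) $ i $ j = matpow A m $ i $ l * A $ l $ j"
      using matrix_mult_entry_attained[of "matpow A m" A i j] by auto
    obtain f where f: "f 0 = i" "f m = l" "matpow A m $ i $ l = (\<Prod>k<m. A $ f k $ f (Suc k))"
      using Suc.IH[of l] False by auto
    have "(\<Prod>k<m. A $ (f(Suc m := j)) k $ (f(Suc m := j)) (Suc k)) = (\<Prod>k<m. A $ f k $ f (Suc k))"
      by (intro prod.cong) auto
    then show ?thesis
      using l f by (intro exI[of _ "f(Suc m := j)"]) simp
  qed
qed

text \<open>Pigeonhole on the n + 1 times 0, ..., n.\<close>

lemma walk_repeats:
  fixes f :: "nat \<Rightarrow> 'n::finite"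
  obtains a b where "a < b" "b \<le> CARD('n)" "f a = f b"
proof -
  have "\<not> inj_on f {..CARD('n)}"
  proof
    assume "inj_on f {..CARD('n)}"
    then have "card (f ` {..CARD('n)}) = Suc CARD('n)" by (simp add: card_image)
    moreover have "card (f ` {..CARD('n)}) \<le> CARD('n)" by (simp add: card_mono)
    ultimately show False by simp
  qed
  then obtain a b where "a \<le> CARD('n)" "b \<le> CARD('n)" "a \<noteq> b" "f a = f b"
    by (auto simp: inj_on_def)
  then show thesis using that[of a b] that[of b a] by (metis nat_neq_iff)
qed

text \<open>A walk of length at least \<open>n\<close> contains a cycle of length at most \<open>n\<close>; cutting it
  out leaves a shorter walk with the same end points.\<close>

lemma matpow_cycle_removal:
  fixes A :: "'a::radicable_idempotent_semifield ^ 'n ^ 'n"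
  assumes "m \<ge> CARD('n)"
  obtains l v where "1 \<le> l" "l \<le> CARD('n)"
    "matpow A m $ i $ j \<le> matpow A l $ v $ v * matpow A (m - l) $ i $ j"
proof -
  have "m \<ge> 1" using assms zero_less_card_finite[where 'a='n] by linarith
  then obtain f where f: "f 0 = i" "f m = j" "matpow A m $ i $ j = (\<Prod>k<m. A $ f k $ f (Suc k))"
    using matpow_entry_walk by blast
  obtain a b where ab: "a < b" "b \<le> CARD('n)" "f a = f b"
    using walk_repeats .
  define w where "w k = A $ f k $ f (Suc k)" for k
  have "b \<le> m" using ab assms by simp
  \<comment> \<open>The walk splits into a head, a closed middle part and a tail; head and tail fit
    together because \<open>f a = f b\<close>.\<close>
  have "prod w {0..<a} * prod w {a..<b} * prod w {b..<m} = prod w {0..<m}"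
    using ab \<open>b \<le> m\<close> by (simp add: prod.atLeastLessThan_concat)
  then have "matpow A m $ i $ j = prod w {a..<b} * (prod w {0..<a} * prod w {b..<m})"
    using f(3) by (simp add: w_def lessThan_atLeast0 ac_simps)
  also have "\<dots> \<le> matpow A (b - a) $ f a $ f b * (matpow A (a - 0) $ f 0 $ f a * matpow A (m - b) $ f b $ f m)"
    unfolding w_def using ab \<open>b \<le> m\<close> by (intro mult_mono prod_walk_le_matpow) auto
  also have "\<dots> \<le> matpow A (b - a) $ f a $ f a * matpow A (a + (m - b)) $ i $ j"
    using matrix_mult_entry_ge[of "matpow A a" i "f a" "matpow A (m - b)" j] f(1,2) ab
    by (auto simp: matpow_add intro!: mult_mono_left)
  also have "a + (m - b) = m - (b - a)" using ab \<open>b \<le> m\<close> by simp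
  finally show thesis using that[of "b - a" "f a"] ab by simp
qed

section \<open>The Kleene star\<close>

lemma kstar_entry: "kstar A $ i $ j = (\<Sum>m<CARD('n). matpow A m $ i $ j)"
  for A :: "'a::semiring_1 ^ 'n ^ 'n"
  by (simp add: kstar_def sum_component)

lemma kstar_entry_attained:
  fixes A :: "'a::radicable_idempotent_semifield ^ 'n ^ 'n"
  obtains m where "m < CARD('n)" "kstar A $ i $ j = matpow A m $ i $ j"
  using sum_attained[of "{..<CARD('n)}" "\<lambda>m. matpow A m $ i $ j"]
  by (auto simp: kstar_entry lessThan_empty_iff)

text \<open>A power of order n or more loses a cycle of weight at most Tr A <= 1 and is thus bounded
  by a smaller power; below n the power is a summand of the star.\<close>

lemma matpow_le_kstar:
  fixes A :: "'a::radicable_idempotent_semifield ^ 'n ^ 'n"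
  assumes "Tr A \<le> 1"
  shows "matpow A m $ i $ j \<le> kstar A $ i $ j"
proof (induction m rule: less_induct)
  case (less m)
  show ?case
  proof (cases "m < CARD('n)")
    case True
    then show ?thesis
      using le_sum[of "{..<CARD('n)}" m "\<lambda>m. matpow A m $ i $ j"] by (simp add: kstar_entry)
  next
    case False
    then obtain l v where l: "1 \<le> l" "l \<le> CARD('n)"
        "matpow A m $ i $ j \<le> matpow A l $ v $ v * matpow A (m - l) $ i $ j"
      using matpow_cycle_removal[of m A i j] by (metis not_less)
    note l(3)
    also have "matpow A l $ v $ v * matpow A (m - l) $ i $ j \<le> 1 * kstar A $ i $ j"
      using l False assms less[of "m - l"] by (intro mult_mono) (auto simp: Tr_le_iff trace_le_iff)
    finally show ?thesis by simp
  qed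
qed

text \<open>Multiplication by A may raise a power to the order n, just outside the star;
  \<open>matpow_le_kstar\<close> absorbs it.\<close>

lemma kstar_mult_le:
  fixes A :: "'a::radicable_idempotent_semifield ^ 'n ^ 'n"
  assumes "Tr A \<le> 1"
  shows "(A ** kstar A) $ i $ j \<le> kstar A $ i $ j"
proof -
  obtain k where k: "(A ** kstar A) $ i $ j = A $ i $ k * kstar A $ k $ j"
    using matrix_mult_entry_attained by blast
  obtain m where m: "kstar A $ k $ j = matpow A m $ k $ j"
    using kstar_entry_attained by blast
  have "A $ i $ k * matpow A m $ k $ j \<le> matpow A (Suc m) $ i $ j"
    using matrix_mult_entry_ge[of A i k "matpow A m" j] by (simp only: matpow_Suc_left)
  also have "\<dots> \<le> kstar A $ i $ j" by (rule matpow_le_kstar[OF assms])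
  finally show ?thesis by (simp add: k m)
qed

lemma kstar_mult_vector_le:
  fixes A :: "'a::radicable_idempotent_semifield ^ 'n ^ 'n"
  assumes "Tr A \<le> 1"
  shows "A *v (kstar A *v u) \<le> kstar A *v u"
  using kstar_mult_le[OF assms]
  unfolding matrix_vector_mul_assoc
  by (auto simp: less_eq_vec_def matrix_vector_mult_def intro!: sum_mono mult_right_mono)

lemma mat_one_le_kstar:
  fixes A :: "'a::radicable_idempotent_semifield ^ 'n ^ 'n"
  shows "mat 1 $ i $ j \<le> kstar A $ i $ j"
  using le_sum[of "{..<CARD('n)}" 0 "\<lambda>m. matpow A m $ i $ j"]
  by (simp add: kstar_entry)

lemma le_kstar_mult_vector:
  fixes A :: "'a::radicable_idempotent_semifield ^ 'n ^ 'n"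
  shows "u \<le> kstar A *v u"
proof (unfold less_eq_vec_def, intro allI)
  fix i
  have "1 * u $ i \<le> kstar A $ i $ i * u $ i"
    using mat_one_le_kstar[of i i A] by (intro mult_right_mono) (auto simp: mat_def)
  also have "\<dots> \<le> (kstar A *v u) $ i" by (rule matrix_vector_mult_ge)
  finally show "u $ i \<le> (kstar A *v u) $ i" by simp
qed

text \<open>By induction every power of A maps x below x, hence so does the star; the converse
  inequality comes from its summand I.\<close>

lemma kstar_mult_vector_fixed:
  fixes A :: "'a::radicable_idempotent_semifield ^ 'n ^ 'n"
  assumes "A *v x \<le> x"
  shows "kstar A *v x = x"
proof (rule antisym)
  have pow: "matpow A m *v x \<le> x" for m
  proof (induction m)
    case (Suc m)
    have "matpow A (Suc m) *v x = A *v (matpow A m *v x)"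
      by (simp only: matpow_Suc_left matrix_vector_mul_assoc)
    also have "\<dots> \<le> A *v x" by (rule matrix_vector_mult_mono[OF Suc])
    finally show ?case using assms by simp
  qed simp
  show "kstar A *v x \<le> x"
  proof (unfold less_eq_vec_def, intro allI)
    fix i
    obtain k where k: "(kstar A *v x) $ i = kstar A $ i $ k * x $ k"
      using matrix_vector_mult_attained by blast
    obtain m where m: "kstar A $ i $ k = matpow A m $ i $ k"
      using kstar_entry_attained by blast
    have "matpow A m $ i $ k * x $ k \<le> (matpow A m *v x) $ i"
      by (rule matrix_vector_mult_ge)
    also have "\<dots> \<le> x $ i" using pow[of m] by (simp add: less_eq_vec_def)
    finally show "(kstar A *v x) $ i \<le> x $ i" by (simp add: k m)
  qed
qed (rule le_kstar_mult_vector)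

section \<open>The spectral radius\<close>

text \<open>For c nonzero, start at a nonzero component of an eigenvector y and move on to the index
  attaching the maximum in each component of A y = c y. Components of y stay nonzero along this
  walk; when it closes up they cancel, and c^l is the weight of a cycle of length l <= n.\<close>

lemma eigenvalue_le:
  fixes A :: "'a::radicable_idempotent_semifield ^ 'n ^ 'n"
  assumes "eigenvalue A c"
  shows "c \<le> (\<Sum>m=1..CARD('n). nth_root m (trace (matpow A m)))"
proof (cases "c = 0")
  case False
  obtain y i where y: "A *v y = c *s y" "y $ i \<noteq> 0"
    using assms by (auto simp: eigenvalue_def vec_eq_iff)
  have ex: "\<exists>l. c * y $ k = A $ k $ l * y $ l" for k
    using matrix_vector_mult_attained[of A y k] y(1) by (metis vector_smult_component)
  then obtain s where s: "c * y $ k = A $ k $ s k * y $ s k" for k by metis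
  define f where "f k = (s ^^ k) i" for k
  have nz: "y $ f k \<noteq> 0" for k
  proof (induction k)
    case (Suc k)
    have "c * y $ f k \<noteq> 0" using Suc False by simp
    then show ?case using s[of "f k"] by (auto simp: f_def)
  qed (simp add: f_def y)
  obtain a b where ab: "a < b" "b \<le> CARD('n)" "f a = f b"
    using walk_repeats .
  from \<open>a < b\<close> have "a \<le> b" by simp
  \<comment> \<open>The relations between consecutive components of y along the walk
    telescope.\<close>
  then have "c ^ (b - a) * y $ f a = (\<Prod>k=a..<b. A $ f k $ f (Suc k)) * y $ f b"
  proof (induction b rule: dec_induct)
    case (step b)
    have "c ^ (Suc b - a) * y $ f a = c * (c ^ (b - a) * y $ f a)"
      using step by (simp add: Suc_diff_le mult.assoc)
    also have "\<dots> = (\<Prod>k=a..<b. A $ f k $ f (Suc k)) * (c * y $ f b)"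
      unfolding step.IH by (simp add: ac_simps)
    also have "c * y $ f b = A $ f b $ f (Suc b) * y $ f (Suc b)"
      using s[of "f b"] by (simp add: f_def)
    finally show ?case using step by (simp add: mult.assoc)
  qed simp
  then have "c ^ (b - a) = (\<Prod>k=a..<b. A $ f k $ f (Suc k))"
    using nonzero_mult_cancel[OF nz[of a]] ab(3) by (metis mult.commute)
  also have "\<dots> \<le> matpow A (b - a) $ f a $ f a"
    using prod_walk_le_matpow[of a b A f] ab by simp
  also have "\<dots> \<le> trace (matpow A (b - a))"
    using trace_le_iff by blast
  finally have "c \<le> nth_root (b - a) (trace (matpow A (b - a)))"
    using ab by (simp add: le_nth_root_iff)
  also have "\<dots> \<le> (\<Sum>m=1..CARD('n). nth_root m (trace (matpow A m)))"
    using le_sum[of "{1..CARD('n)}" "b - a" "\<lambda>m. nth_root m (trace (matpow A m))"]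
      ab(1) le_trans[OF diff_le_self ab(2)] by simp
  finally show ?thesis .
qed simp

text \<open>Let r be the value of the formula. If r = 0, A is nilpotent and a nonzero column of its
  last nonzero power is sent to 0. Otherwise A is scaled to B, whose cycles have weight at most 1,
  and the column of the star of B at an index on a cycle of weight 1 is fixed by B.\<close>

lemma eigenvalue_attained:
  fixes A :: "'a::radicable_idempotent_semifield ^ 'n ^ 'n"
  shows "eigenvalue A (\<Sum>m=1..CARD('n). nth_root m (trace (matpow A m)))"
proof -
  define r where "r = (\<Sum>m=1..CARD('n). nth_root m (trace (matpow A m)))"
  have r: "trace (matpow A m) \<le> r ^ m" if "m \<in> {1..CARD('n)}" for m
    using le_sum[of "{1..CARD('n)}" m "\<lambda>m. nth_root m (trace (matpow A m))"] that
    by (simp add: r_def nth_root_le_iff)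
  have "eigenvalue A r"
  proof (cases "r = 0")
    case True
    \<comment> \<open>Cycles of length at most n have weight 0, and every walk of length n contains
      one.\<close>
    have "matpow A CARD('n) $ i $ j = 0" for i j
    proof -
      obtain l v where l: "1 \<le> l" "l \<le> CARD('n)"
          "matpow A CARD('n) $ i $ j \<le> matpow A l $ v $ v * matpow A (CARD('n) - l) $ i $ j"
        using matpow_cycle_removal[of "CARD('n)" A i j] by auto
      have "trace (matpow A l) \<le> 0"
        using r[of l] l True by (simp add: power_0_left)
      then have "matpow A l $ v $ v \<le> 0"
        by (simp only: trace_le_iff)
      then show ?thesis using l(3) by simp
    qed
    then have "matpow A CARD('n) = 0" by (simp add: vec_eq_iff)
    moreover have "matpow A 0 \<noteq> 0"
      by (simp add: vec_eq_iff mat_def)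
    ultimately obtain p where p: "matpow A p \<noteq> 0" "matpow A (Suc p) = 0"
      using ex_least_nat_less[of "\<lambda>p. matpow A p = 0" "CARD('n)"] by blast
    then obtain i j where ij: "matpow A p $ i $ j \<noteq> 0"
      by (auto simp: vec_eq_iff)
    have "A *v column j (matpow A p) = column j (A ** matpow A p)"
      by (simp add: vec_eq_iff column_def matrix_vector_mult_def matrix_matrix_mult_def)
    also have "\<dots> = r *s column j (matpow A p)"
      using p(2) True by (simp add: matpow_Suc_left vec_eq_iff column_def del: matpow.simps)
    finally show ?thesis
      unfolding eigenvalue_def using ij
      by (intro exI[of _ "column j (matpow A p)"]) (auto simp: column_def vec_eq_iff)
  next
    case False
    define B where "B = matscale (inverse r) A"
    have trB: "trace (matpow B m) = inverse r ^ m * trace (matpow A m)" for m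
      by (simp add: B_def matpow_matscale trace_matscale)
    have TrB: "Tr B \<le> 1"
      unfolding Tr_le_iff trB using r inverse_power_mult_le_one_iff[OF False] by blast
    obtain m where m: "m \<in> {1..CARD('n)}" "r = nth_root m (trace (matpow A m))"
      using sum_attained[of "{1..CARD('n)}" "\<lambda>m. nth_root m (trace (matpow A m))"]
      unfolding r_def by (auto simp: Suc_le_eq)
    then have "trace (matpow A m) = r ^ m" using nth_root_power[of m "trace (matpow A m)"] by simp
    then have "trace (matpow B m) = 1"
      using right_inverse_nonzero[OF False] by (simp add: trB mult.commute flip: power_mult_distrib)
    \<comment> \<open>The m attaining r provides a closed walk of weight 1 through i.\<close>
    then obtain i where i: "matpow B m $ i $ i = 1"
      using sum_attained[of UNIV "\<lambda>i. matpow B m $ i $ i"] by (auto simp: trace_def)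
    obtain q where q: "m = Suc q" using m(1) by (cases m) auto
    have shift: "matpow B (Suc p) $ k $ i \<le> (B ** kstar B) $ k $ i" for p k
      unfolding matpow_Suc_left matrix_matrix_mult_def
      by (auto intro!: sum_mono mult_mono_left matpow_le_kstar[OF TrB])
    \<comment> \<open>Only the summand I of the star could get lost; in column i its entry 1 is
      matched by the closed walk of length m through i.\<close>
    have "kstar B $ k $ i \<le> (B ** kstar B) $ k $ i" for k
    proof -
      obtain p where p: "kstar B $ k $ i = matpow B p $ k $ i"
        using kstar_entry_attained by blast
      show ?thesis
      proof (cases p)
        case 0
        then show ?thesis using p shift[of q i] i q by (auto simp: mat_def)
      next
        case (Suc p')
        then show ?thesis using p shift[of p' k] by simp
      qed
    qed
    then have eq: "(B ** kstar B) $ k $ i = kstar B $ k $ i" for k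
      using kstar_mult_le[OF TrB, of k i] by (simp add: order.antisym)
    define y where "y = column i (kstar B)"
    have "B *v y = y"
      using eq by (simp add: y_def vec_eq_iff column_def matrix_vector_mult_def matrix_matrix_mult_def)
    then have "inverse r *s (A *v y) = y"
      by (simp add: B_def matscale_matrix_vector_mult)
    then have "r *s y = A *v y"
      using right_inverse_nonzero[OF False] by (metis vector_smult_assoc vector_smult_lid)
    moreover have "y $ i \<noteq> 0"
      using mat_one_le_kstar[of i i B] by (auto simp: y_def column_def mat_def)
    ultimately show ?thesis
      unfolding eigenvalue_def by (intro exI[of _ y]) auto
  qed
  then show ?thesis by (simp add: r_def)
qed

lemma spectral_radius_eq:
  fixes A :: "'a::radicable_idempotent_semifield ^ 'n ^ 'n"
  shows "spectral_radius A = (\<Sum>m=1..CARD('n). nth_root m (trace (matpow A m)))"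
  unfolding spectral_radius_def
  by (rule Greatest_equality) (rule eigenvalue_attained, rule eigenvalue_le)

lemma spectral_radius_le_iff:
  fixes A :: "'a::radicable_idempotent_semifield ^ 'n ^ 'n"
  shows "spectral_radius A \<le> t \<longleftrightarrow> (\<forall>m\<in>{1..CARD('n)}. trace (matpow A m) \<le> t ^ m)"
  by (simp add: spectral_radius_eq sum_le_iff nth_root_le_iff)

section \<open>Traces of mixed products of A and C\<close>

text \<open>Both parts of \<open>theta\<close> merge into one root-free condition: lists of sum 0
  give the traces of powers of A up to n, and a positive sum forces length below n, as in
  \<open>exponent_tuples\<close>.\<close>

lemma theta_le_iff:
  fixes A C :: "'a::radicable_idempotent_semifield ^ 'n ^ 'n"
  shows "theta A C \<le> t \<longleftrightarrow>
    (\<forall>is. is \<noteq> [] \<and> length is + sum_list is \<le> CARD('n) \<longrightarrow>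
       trace (alt_prod A C is) \<le> t ^ length is)" (is "_ \<longleftrightarrow> ?R")
proof -
  have "theta A C \<le> t \<longleftrightarrow> (\<forall>m\<in>{1..CARD('n)}. trace (matpow A m) \<le> t ^ m) \<and>
      (\<forall>k\<in>{1..<CARD('n)}. \<forall>is\<in>exponent_tuples CARD('n) k. trace (alt_prod A C is) \<le> t ^ k)"
    by (simp add: theta_def add_le_iff spectral_radius_le_iff sum_le_iff finite_exponent_tuples
        nth_root_le_iff)
  also have "\<dots> \<longleftrightarrow> ?R"
  proof (intro iffI allI impI conjI ballI)
    fix "is" :: "nat list"
    assume L: "(\<forall>m\<in>{1..CARD('n)}. trace (matpow A m) \<le> t ^ m) \<and>
      (\<forall>k\<in>{1..<CARD('n)}. \<forall>is\<in>exponent_tuples CARD('n) k. trace (alt_prod A C is) \<le> t ^ k)"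
      and "is": "is \<noteq> [] \<and> length is + sum_list is \<le> CARD('n)"
    from "is" have len: "length is \<ge> 1" by (cases "is") auto
    show "trace (alt_prod A C is) \<le> t ^ length is"
    proof (cases "sum_list is = 0")
      case True
      then have "is = replicate (length is) 0"
        by (intro replicate_eqI) auto
      then have "alt_prod A C is = matpow A (length is)"
        using alt_prod_replicate_zero by metis
      then show ?thesis using L "is" len by auto
    next
      case False
      then have "sum_list is \<ge> 1" by linarith
      then have "length is \<in> {1..<CARD('n)}" "is \<in> exponent_tuples CARD('n) (length is)"
        using "is" len by (auto simp: exponent_tuples_def simp del: sum_list_eq_0_iff)
      then show ?thesis using L by blast
    qed
  next
    fix m assume R: ?R and m: "m \<in> {1..CARD('n)}"
    then have "trace (alt_prod A C (replicate m 0)) \<le> t ^ m"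
      using R[rule_format, of "replicate m 0"] by (auto simp: sum_list_replicate)
    then show "trace (matpow A m) \<le> t ^ m" by (simp add: alt_prod_replicate_zero)
  next
    fix k "is" assume R: ?R and "k \<in> {1..<CARD('n)}" "is \<in> exponent_tuples CARD('n) k"
    then show "trace (alt_prod A C is) \<le> t ^ k"
      using R[rule_format, of "is"] by (cases "is") (auto simp: exponent_tuples_def)
  qed
  finally show ?thesis .
qed

text \<open>A product of \<open>m\<close> factors from \<open>{A, C}\<close> is sorted into blocks \<open>A C\<^sup>i\<close>, with
  the leading factors \<open>C\<close> kept separately.\<close>

lemma matpow_add_entry_le:
  fixes A C :: "'a::radicable_idempotent_semifield ^ 'n ^ 'n"
  shows "\<exists>p is. p + length is + sum_list is = m \<and>
    matpow (A + C) m $ i $ j \<le> (matpow C p ** alt_prod A C is) $ i $ j"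
proof (induction m arbitrary: i)
  case 0
  then show ?case by (intro exI[of _ 0] exI[of _ "[]"]) simp
next
  case (Suc m)
  obtain k where k: "matpow (A + C) (Suc m) $ i $ j = (A + C) $ i $ k * matpow (A + C) m $ k $ j"
    using matrix_mult_entry_attained[of "A + C"] unfolding matpow_Suc_left by blast
  obtain p "is" where IH: "p + length is + sum_list is = m"
      "matpow (A + C) m $ k $ j \<le> (matpow C p ** alt_prod A C is) $ k $ j"
    using Suc by blast
  have step: "X $ i $ k * matpow (A + C) m $ k $ j \<le> (X ** (matpow C p ** alt_prod A C is)) $ i $ j" for X
    using mult_mono_left[OF IH(2), of "X $ i $ k"]
      matrix_mult_entry_ge[of X i k "matpow C p ** alt_prod A C is" j] by (rule order.trans)
  \<comment> \<open>A new leading A takes the p pending factors C as the exponent of its block; a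
    new leading C increases p.\<close>
  consider "(A + C) $ i $ k = A $ i $ k" | "(A + C) $ i $ k = C $ i $ k"
    using add_cases[of "A $ i $ k" "C $ i $ k"] by auto
  then show ?case
  proof cases
    case 1
    then show ?thesis using step[of A] IH(1) unfolding k
      by (intro exI[of _ 0] exI[of _ "p # is"]) (simp add: matrix_mul_assoc)
  next
    case 2
    then show ?thesis using step[of C] IH(1) unfolding k
      by (intro exI[of _ "Suc p"] exI[of _ "is"])
        (simp add: matrix_mul_assoc matpow_Suc_left del: matpow.simps)
  qed
qed

text \<open>Under the trace, the leading power of C rotates to the end and joins the last exponent,
  with the total number of factors unchanged. A product without A is a power of C, covered by Tr C
  <= 1.\<close>

lemma Tr_add_le_one:
  fixes A C :: "'a::radicable_idempotent_semifield ^ 'n ^ 'n"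
  assumes C: "Tr C \<le> 1"
    and AC: "\<And>is. is \<noteq> [] \<Longrightarrow> length is + sum_list is \<le> CARD('n) \<Longrightarrow> trace (alt_prod A C is) \<le> 1"
  shows "Tr (A + C) \<le> 1"
  unfolding Tr_le_iff trace_le_iff
proof (intro ballI allI)
  fix m i assume m: "m \<in> {1..CARD('n)}"
  obtain p "is" where pis: "p + length is + sum_list is = m"
      "matpow (A + C) m $ i $ i \<le> (matpow C p ** alt_prod A C is) $ i $ i"
    using matpow_add_entry_le by blast
  note pis(2)
  also have "(matpow C p ** alt_prod A C is) $ i $ i \<le> trace (matpow C p ** alt_prod A C is)"
    using trace_le_iff by blast
  also have "\<dots> \<le> 1"
  proof (cases "is" rule: rev_cases)
    case Nil
    then show ?thesis using C pis(1) m by (simp add: Tr_le_iff)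
  next
    case (snoc js q)
    have "trace (matpow C p ** alt_prod A C is) = trace (alt_prod A C is ** matpow C p)"
      by (rule trace_mul_sym)
    also have "alt_prod A C is ** matpow C p = alt_prod A C (js @ [q + p])"
      by (simp add: snoc alt_prod_append matpow_add matrix_mul_assoc)
    also have "trace \<dots> \<le> 1" using AC[of "js @ [q + p]"] pis(1) m snoc by simp
    finally show ?thesis .
  qed
  finally show "matpow (A + C) m $ i $ i \<le> 1" .
qed

text \<open>\<open>theta_le_iff\<close> at t = \<open>theta A C\<close> bounds the trace of a
  product with k blocks by the k-th power of t; scaling each of its k factors A by the inverse of t
  turns the bound into 1.\<close>

lemma Tr_theta_le_one:
  fixes A C :: "'a::radicable_idempotent_semifield ^ 'n ^ 'n"
  assumes "theta A C \<noteq> 0" "Tr C \<le> 1"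
  shows "Tr (matscale (inverse (theta A C)) A + C) \<le> 1"
  using assms theta_le_iff[of A C "theta A C"]
  by (intro Tr_add_le_one)
    (auto simp: alt_prod_matscale trace_matscale inverse_power_mult_le_one_iff)

section \<open>The optimisation problem\<close>

text \<open>A bound on the double sum is a bound on each of its terms, where the inverse of a
  nonzero component can be moved across.\<close>

lemma objective_le_iff:
  fixes A :: "'a::radicable_idempotent_semifield ^ 'n ^ 'n"
  assumes "regular x"
  shows "objective A x \<le> t \<longleftrightarrow> A *v x \<le> t *s x"
proof -
  have "objective A x \<le> t \<longleftrightarrow> (\<forall>i j. inverse (x $ j) * (A $ j $ i * x $ i) \<le> t)"
    by (simp add: objective_def conj_vec_def vector_matrix_mult_def sum_le_iff
        sum_distrib_left sum_distrib_right ac_simps)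
  also have "\<dots> \<longleftrightarrow> (\<forall>i j. A $ j $ i * x $ i \<le> t * x $ j)"
    using assms by (simp add: regular_def inverse_mult_le_iff mult.commute)
  also have "\<dots> \<longleftrightarrow> A *v x \<le> t *s x"
    by (auto simp: less_eq_vec_def matrix_vector_mult_def sum_le_iff)
  finally show ?thesis .
qed

lemma theta_le_objective:
  fixes A C :: "'a::radicable_idempotent_semifield ^ 'n ^ 'n"
  assumes "feasible C g x"
  shows "theta A C \<le> objective A x"
proof -
  define t where "t = objective A x"
  have x: "regular x" "C *v x \<le> x" using assms by (auto simp: feasible_def)
  then have Ax: "A *v x \<le> t *s x" using objective_le_iff[of x A t] by (simp add: t_def)
  have scale_mono: "c *s y \<le> c *s z" if "y \<le> z" for c and y z :: "'a ^ 'n"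
    using that by (simp add: less_eq_vec_def mult_mono_left)
  have Cp: "matpow C p *v x \<le> x" for p
  proof (induction p)
    case (Suc p)
    have "matpow C (Suc p) *v x = matpow C p *v (C *v x)"
      by (simp add: matrix_vector_mul_assoc)
    also have "\<dots> \<le> matpow C p *v x" by (rule matrix_vector_mult_mono[OF x(2)])
    finally show ?case using Suc by simp
  qed simp
  have alt: "alt_prod A C is *v x \<le> t ^ length is *s x" for "is"
  proof (induction "is")
    case (Cons i "is")
    have "alt_prod A C (i # is) *v x = A *v (matpow C i *v (alt_prod A C is *v x))"
      by (simp add: matrix_vector_mul_assoc matrix_mul_assoc)
    also have "\<dots> \<le> A *v (matpow C i *v (t ^ length is *s x))"
      by (intro matrix_vector_mult_mono Cons)
    also have "\<dots> = t ^ length is *s (A *v (matpow C i *v x))"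
      by (simp add: matrix_vector_mult_scale)
    also have "\<dots> \<le> t ^ length is *s (A *v x)"
      by (intro scale_mono matrix_vector_mult_mono Cp)
    also have "\<dots> \<le> t ^ length is *s (t *s x)" by (intro scale_mono Ax)
    finally show ?case by (simp add: vector_smult_assoc mult.commute)
  qed simp
  \<comment> \<open>In component i only the diagonal term is kept, and the nonzero
    \<open>x $ i\<close> cancels.\<close>
  have "trace (alt_prod A C is) \<le> t ^ length is" for "is"
    unfolding trace_le_iff
  proof
    fix i
    have "alt_prod A C is $ i $ i * x $ i \<le> (alt_prod A C is *v x) $ i"
      by (rule matrix_vector_mult_ge)
    also have "\<dots> \<le> t ^ length is * x $ i" using alt[of "is"] by (simp add: less_eq_vec_def)
    finally show "alt_prod A C is $ i $ i \<le> t ^ length is"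
      using mult_le_mult_iff[of "x $ i"] x(1) by (metis mult.commute regular_def)
  qed
  then show ?thesis unfolding t_def by (simp add: theta_le_iff)
qed

text \<open>Merges the bound on the objective and the constraint into one inequality, so that the
  star solves both at once.\<close>

lemma add_mult_vector_le_iff:
  fixes A C :: "'a::radicable_idempotent_semifield ^ 'n ^ 'n"
  assumes "c \<noteq> 0"
  shows "(matscale (inverse c) A + C) *v x \<le> x \<longleftrightarrow> A *v x \<le> c *s x \<and> C *v x \<le> x"
  by (auto simp: less_eq_vec_def matrix_vector_mult_add_rdistrib matscale_matrix_vector_mult
      add_le_iff inverse_mult_le_iff[OF assms])

theorem theorem3:
  fixes A C :: "'a::radicable_idempotent_semifield ^ 'n ^ 'n"
    and g :: "'a ^ 'n"
  assumes "spectral_radius A > 0"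
    and "Tr C \<le> 1"
  shows "(\<exists>x. feasible C g x \<and> objective A x = theta A C) \<and>
    (\<forall>x. feasible C g x \<longrightarrow> theta A C \<le> objective A x) \<and>
    (\<forall>x. regular x \<longrightarrow>
       (is_arg_min (objective A) (feasible C g) x \<longleftrightarrow>
        (\<exists>u. regular u \<and> g \<le> u \<and>
             x = kstar (matscale (inverse (theta A C)) A + C) *v u)))"
proof -
  define M where "M = matscale (inverse (theta A C)) A + C"
  have "spectral_radius A \<le> theta A C"
    unfolding theta_def using add_le_iff by blast
  then have nz: "theta A C \<noteq> 0" using assms(1) by auto
  have TrM: "Tr M \<le> 1" unfolding M_def by (rule Tr_theta_le_one[OF nz assms(2)])
  have opt_iff: "feasible C g x \<and> objective A x \<le> theta A C \<longleftrightarrow> M *v x \<le> x \<and> g \<le> x"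
    if "regular x" for x
    using that by (auto simp: feasible_def M_def add_mult_vector_le_iff[OF nz] objective_le_iff)
  have sol: "feasible C g (kstar M *v u) \<and> objective A (kstar M *v u) = theta A C"
    if u: "regular u" "g \<le> u" for u
  proof -
    have le: "u \<le> kstar M *v u" by (rule le_kstar_mult_vector)
    have "regular (kstar M *v u)"
      unfolding regular_def
    proof
      fix i
      show "(kstar M *v u) $ i \<noteq> 0"
        using le u(1) unfolding less_eq_vec_def regular_def by (metis le_zero_eq)
    qed
    then have "feasible C g (kstar M *v u) \<and> objective A (kstar M *v u) \<le> theta A C"
      using opt_iff kstar_mult_vector_le[OF TrM, of u] le u(2) by (metis order.trans)
    then show ?thesis using theta_le_objective by (metis order.antisym)
  qed
  \<comment> \<open>Adding 1 makes g regular even where it has zero components; the star then yields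
    a feasible point attaining \<open>theta A C\<close>.\<close>
  define u0 where "u0 = (\<chi> i. g $ i + 1)"
  have u0: "regular u0" "g \<le> u0"
    using add_le_iff[of "g $ i" 1 "g $ i + 1" for i]
    by (auto simp: u0_def regular_def less_eq_vec_def)
  \<comment> \<open>\<open>is_arg_min\<close> only excludes strictly smaller values; as
    \<open>theta A C\<close> is attained and the order is total, this bounds the objective by
    it.\<close>
  have arg_min: "is_arg_min (objective A) (feasible C g) x \<longleftrightarrow>
      feasible C g x \<and> objective A x \<le> theta A C" for x
    using sol[OF u0] theta_le_objective[of C g _ A] by (force simp: is_arg_min_def)
  have "is_arg_min (objective A) (feasible C g) x \<longleftrightarrow>
      (\<exists>u. regular u \<and> g \<le> u \<and> x = kstar M *v u)" if x: "regular x" for x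
  proof
    assume "is_arg_min (objective A) (feasible C g) x"
    then have "M *v x \<le> x" "g \<le> x" using arg_min opt_iff[OF x] by auto
    \<comment> \<open>The witness is u = x, since the star of M fixes x.\<close>
    then show "\<exists>u. regular u \<and> g \<le> u \<and> x = kstar M *v u"
      using x kstar_mult_vector_fixed[of M x] by metis
  next
    assume "\<exists>u. regular u \<and> g \<le> u \<and> x = kstar M *v u"
    then show "is_arg_min (objective A) (feasible C g) x"
      using sol arg_min by auto
  qed
  then show ?thesis
    using sol[OF u0] theta_le_objective[of C g _ A] unfolding M_def by blast
qed

end
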